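(* Let $N$ be an odd perfect number. If $3 \nmid N$, then $$\Omega(N) \geq \frac{8}{3}\,\omega(N)-\frac{7}{3}.$$ If $3 \mid N$, then $$\Omega(N) \geq \frac{21}{8}\,\omega(N)-\frac{39}{8}.$$
   Context: For a positive integer $n$, $\Omega(n)$ denotes the total number of prime divisors of $n$ counted with multiplicity, and $\omega(n)$ denotes the number of distinct prime divisors of $n$. A positive integer $N$ is perfect if $\sigma(N)=2N$, where $\sigma(N)$ is the sum of the positive divisors of $N$. *)

theory Defs
  imports Complex_Main "HOL-Computational_Algebra.Primes"
begin

definition big_omega :: "nat \<Rightarrow> nat" where
  "big_omega n = size (prime_factorization n)"

definition small_omega :: "nat \<Rightarrow> nat" where
  "small_omega n = card (prime_factors n)"

definition divisor_sum :: "nat \<Rightarrow> nat" where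
  "divisor_sum n = (\<Sum>d | d dvd n. d)"

(* Positivity is needed: 0 has infinitely many divisors, so divisor_sum 0 = 0 = 2 * 0. *)
definition perfect :: "nat \<Rightarrow> bool" where
  "perfect n \<longleftrightarrow> n > 0 \<and> divisor_sum n = 2 * n"

end

theory Submission
  imports Defs "HOL-Number_Theory.Residues"
begin

text \<open>
  Write the odd perfect number as \<open>N\<close>. The primes of exponent 2 are the ones that keep
  \<open>\<Omega>(N)\<close> small compared with \<open>\<omega>(N)\<close>, so the theorem says that there cannot be too many of them.
  If \<open>c\<close> is such a prime, then \<open>\<sigma>(c\<^sup>2) = c\<^sup>2 + c + 1\<close> divides \<open>\<sigma>(N) = 2N\<close>, and a prime factor of
  \<open>c\<^sup>2 + c + 1\<close> other than 3 is \<open>1 mod 3\<close>. The factor 3 occurs exactly when \<open>c \<equiv> 1 (mod 3)\<close>, and then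
  only once; removing it leaves the number \<open>core c\<close>.

  Disregard the prime 3, and let \<open>U\<close> and \<open>V\<close> be the sets of primes of exponent 2 that are 1 and 2 mod 3,
  and \<open>T\<close> the set of the remaining prime factors of \<open>N\<close>. Let \<open>u, v, t\<close> be their sizes, let \<open>R\<close> be the
  sum of the exponents over \<open>T\<close>, and \<open>e\<close> the exponent of 3. Then \<open>\<Omega>(N) = e + 2u + 2v + R\<close>, and the
  proof rests on the following facts.

  \<^item> \<open>u \<le> e\<close>, since each \<open>c \<in> U\<close> contributes a factor 3 to \<open>N\<close>; in particular \<open>U\<close> is empty if \<open>3\<close> does not
    divide \<open>N\<close>.
  \<^item> \<open>R \<ge> 4t - 3\<close>, since the exponents on \<open>T\<close> are at least 4 except for at most one prime of odd
    exponent (\<open>sum_expo_T\<close>).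
  \<^item> The prime factors of the numbers \<open>core c\<close> lie in \<open>U \<union> T\<close>, because no element of \<open>V\<close> is 1 mod 3. So
    they number at most \<open>2u + R\<close> in total, with multiplicity (\<open>sum_big_omega_core\<close>).
  \<^item> At most \<open>u + t\<close> elements \<open>c\<close> of \<open>V\<close> have \<open>\<Omega>(core c) \<le> 2\<close>: then \<open>core c\<close> has a prime factor
    \<open>q > c\<close>, and \<open>q\<close> determines \<open>c\<close> (\<open>card_V_at_most_two\<close>).
  \<^item> At most \<open>u + t\<close> elements \<open>c\<close> of \<open>U \<union> V\<close> have \<open>core c\<close> prime, because this prime determines \<open>c\<close>
    (\<open>card_core_prime\<close>).

  The numbers \<open>\<Omega>(core c)\<close> are at least 1. Counting 2 for each element of \<open>U\<close> and 3 for each element of \<open>V\<close>,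
  with a correction of 1 for each exception bounded by the last two facts, turns the third fact into a linear
  upper bound on \<open>v\<close>. Both claims are then linear consequences of these inequalities.
\<close>

section \<open>Numbers with few prime factors\<close>

lemma prime_if_big_omega_le_1:
  assumes "n > 1" "big_omega n \<le> 1"
  shows "prime n"
proof -
  have pm: "prod_mset (prime_factorization n) = n"
    using assms(1) by (intro prod_mset_prime_factorization_nat) simp
  have "prime_factorization n \<noteq> {#}"
    using pm assms(1) by (metis less_irrefl prod_mset_empty)
  then have "size (prime_factorization n) = 1"
    using assms(2) nonempty_has_size[of "prime_factorization n"] by (simp add: big_omega_def)
  from size_1_singleton_mset[OF this] obtain p where p: "prime_factorization n = {#p#}" ..
  then have "p \<in> prime_factors n" by simp
  then have "prime p" by (rule in_prime_factors_imp_prime)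
  moreover have "p = n" using pm unfolding p by simp
  ultimately show ?thesis by simp
qed

lemma prod_mset_le_power_size:
  fixes M :: "nat multiset"
  assumes "\<And>x. x \<in># M \<Longrightarrow> x \<le> b"
  shows "prod_mset M \<le> b ^ size M"
  using assms by (induction M) (auto intro!: mult_mono)

section \<open>The sum of divisors as a multiplicative function\<close>

lemma divisor_sum_prime_power:
  assumes "prime p"
  shows "divisor_sum (p ^ k) = (\<Sum>i\<le>k. p ^ i)"
proof -
  have "{d. d dvd p ^ k} = (\<lambda>i. p ^ i) ` {..k}"
    using divides_primepow_nat[OF assms] by auto
  moreover have "inj_on (\<lambda>i. p ^ i) {..k}"
    using prime_gt_1_nat[OF assms] by (auto intro!: inj_onI)
  ultimately show ?thesis
    by (simp add: divisor_sum_def sum.reindex)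
qed

text \<open>
  Multiplication is a bijection from pairs of divisors of coprime \<open>a\<close> and \<open>b\<close> to divisors of \<open>a * b\<close>.
\<close>
lemma divisor_sum_mult_coprime:
  assumes "coprime a b"
  shows "divisor_sum (a * b) = divisor_sum a * divisor_sum b"
proof -
  have inj: "inj_on (\<lambda>(x, y). x * y) ({d. d dvd a} \<times> {d. d dvd b})"
  proof (rule inj_onI, clarify)
    fix x y x' y' assume d: "x dvd a" "y dvd b" "x' dvd a" "y' dvd b" and e: "x * y = x' * y'"
    have "coprime x y'" "coprime y x'"
      using assms d by (meson coprime_divisors coprime_commute)+
    then show "x = x' \<and> y = y'"
      using coprime_crossproduct_nat[of x y' x' y] e by (simp add: coprime_commute mult.commute)
  qed
  have img: "{d. d dvd a * b} = (\<lambda>(x, y). x * y) ` ({d. d dvd a} \<times> {d. d dvd b})"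
    using division_decomp[of _ a b] by (fastforce intro: mult_dvd_mono)
  show ?thesis
    unfolding divisor_sum_def img sum.reindex[OF inj]
    by (simp add: sum_product sum.cartesian_product comp_def case_prod_beta)
qed

lemma divisor_sum_prod_prime_powers:
  assumes "finite A" "\<And>p. p \<in> A \<Longrightarrow> prime p"
  shows "divisor_sum (\<Prod>p\<in>A. p ^ e p) = (\<Prod>p\<in>A. \<Sum>i\<le>e p. p ^ i)"
  using assms
proof (induction rule: finite_induct)
  case empty
  show ?case by (simp add: divisor_sum_def)
next
  case (insert q A)
  have "coprime (q ^ e q) (\<Prod>p\<in>A. p ^ e p)"
    using insert by (intro prod_coprime_right) (auto intro!: primes_coprime)
  then show ?case
    using insert by (simp add: divisor_sum_mult_coprime divisor_sum_prime_power)
qed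

lemma divisor_sum_eq_prod:
  assumes "n > 0"
  shows "divisor_sum n = (\<Prod>p\<in>prime_factors n. \<Sum>i\<le>multiplicity p n. p ^ i)"
  using divisor_sum_prod_prime_powers[of "prime_factors n" "\<lambda>p. multiplicity p n"]
    prime_factorization_nat[OF assms] by (simp add: in_prime_factors_iff)

section \<open>Prime factors of \<open>c\<^sup>2 + c + 1\<close>\<close>

text \<open>
  The third cyclotomic polynomial; its value at a prime \<open>c\<close> is \<open>\<sigma>(c\<^sup>2)\<close>.
\<close>
abbreviation Phi3 :: "nat \<Rightarrow> nat" where
  "Phi3 c \<equiv> c ^ 2 + c + 1"

text \<open>
  The part of \<open>c\<^sup>2 + c + 1\<close> that is prime to 3, see \<open>not_3_dvd_core\<close>.
\<close>
definition core :: "nat \<Rightarrow> nat" where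
  "core c = (if c mod 3 = 1 then Phi3 c div 3 else Phi3 c)"

lemma Phi3_eq_core: "Phi3 c = (if c mod 3 = 1 then 3 else 1) * core c"
proof (cases "c mod 3 = 1")
  case True
  then have "c = 3 * (c div 3) + 1" by presburger
  then obtain k where "c = 3 * k + 1" by blast
  then have "Phi3 c = 3 * (3 * k ^ 2 + 3 * k + 1)"
    by (simp add: power2_eq_square algebra_simps)
  then have "3 dvd Phi3 c" by (metis dvd_triv_left)
  then show ?thesis using True by (simp add: core_def)
qed (simp add: core_def)

lemma not_3_dvd_core: "\<not> 3 dvd core c"
proof -
  define k where "k = c div 3"
  have "(c mod 3 = 0 \<and> c = 3 * k) \<or> (c mod 3 = 1 \<and> c = 3 * k + 1) \<or> (c mod 3 = 2 \<and> c = 3 * k + 2)"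
    unfolding k_def by presburger
  then have "\<exists>m. core c = 3 * m + 1"
  proof (elim disjE conjE)
    assume 1: "c mod 3 = 0" "c = 3 * k"
    have "core c = 3 * (3 * k ^ 2 + k) + 1"
      unfolding core_def 1(2) by (simp add: power2_eq_square)
    then show ?thesis by blast
  next
    assume 2: "c mod 3 = 1" "c = 3 * k + 1"
    have "Phi3 c = 3 * (3 * (k ^ 2 + k) + 1)"
      unfolding 2(2) by (simp add: power2_eq_square algebra_simps)
    then have "core c = 3 * (k ^ 2 + k) + 1"
      using 2(1) by (simp add: core_def del: One_nat_def)
    then show ?thesis by blast
  next
    assume 3: "c mod 3 = 2" "c = 3 * k + 2"
    have "Phi3 c = 3 * (3 * k ^ 2 + 5 * k + 2) + 1"
      unfolding 3(2) by (simp add: power2_eq_square algebra_simps)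
    then have "core c = 3 * (3 * k ^ 2 + 5 * k + 2) + 1"
      unfolding core_def using 3(1) by simp
    then show ?thesis by blast
  qed
  then obtain m where "core c = 3 * m + 1" by blast
  then show ?thesis by presburger
qed

lemma core_gt_1: "c > 1 \<Longrightarrow> core c > 1"
proof -
  assume c: "c > 1"
  have "c * c \<ge> 2 * c" using c by simp
  then have "Phi3 c > 3" unfolding power2_eq_square using c by linarith
  then show ?thesis using Phi3_eq_core[of c] by (cases "c mod 3 = 1") auto
qed

text \<open>
  As \<open>c\<^sup>3 - 1 = (c - 1) (c\<^sup>2 + c + 1)\<close>, the residue \<open>c\<close> has order 1 or 3 modulo \<open>r\<close>. If \<open>r \<equiv> 2 (mod 3)\<close>,
  then 3 is prime to \<open>r - 1\<close>, so by Fermat's little theorem the order is 1; but then \<open>c\<^sup>2 + c + 1 \<equiv> 3\<close>.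
\<close>
lemma prime_dvd_Phi3_mod_3:
  assumes "prime r" "r dvd Phi3 c" "r \<noteq> 3"
  shows "r mod 3 = 1"
proof (rule ccontr)
  assume "r mod 3 \<noteq> 1"
  moreover have "\<not> 3 dvd r"
    using assms(1,3) primes_dvd_imp_eq[of 3 r] by auto
  ultimately have "r mod 3 = 2" by presburger
  then have "r - 1 = 3 * (r div 3) + 1" by presburger
  then obtain k where k: "r - 1 = 3 * k + 1" by blast
  have P0: "[Phi3 c = 0] (mod r)" using assms(2) by (simp add: cong_0_iff)
  have "c ^ 3 + Phi3 c = c * Phi3 c + 1"
    by (simp add: power2_eq_square power3_eq_cube algebra_simps)
  moreover have "[c ^ 3 + Phi3 c = c ^ 3 + 0] (mod r)"
    by (intro cong_add cong_refl P0)
  moreover have "[c * Phi3 c + 1 = c * 0 + 1] (mod r)"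
    by (intro cong_add cong_mult cong_refl P0)
  ultimately have "[c ^ 3 + 0 = c * 0 + 1] (mod r)"
    unfolding cong_def by argo
  then have c3: "[c ^ 3 = 1] (mod r)" by simp
  have ndvd: "\<not> r dvd c"
  proof
    assume "r dvd c"
    then have "r dvd c ^ 2 + c" by (simp add: power2_eq_square)
    then have "r dvd 1" using assms(2) by (simp add: dvd_add_right_iff del: One_nat_def)
    then show False using assms(1) by simp
  qed
  have "[c ^ (3 * k + 1) = 1] (mod r)"
    using fermat_theorem[OF assms(1) ndvd] k by simp
  moreover have "[c ^ (3 * k + 1) = 1 ^ k * c] (mod r)"
    unfolding power_add power_mult power_one_right
    by (intro cong_mult cong_pow c3 cong_refl)
  ultimately have c1: "[c = 1] (mod r)"
    by (simp add: cong_def)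
  have "[Phi3 c = 1 ^ 2 + 1 + 1] (mod r)"
    by (intro cong_add cong_pow c1 cong_refl)
  then have "[3 = 0] (mod r)"
    using P0 by (simp add: cong_def numeral_3_eq_3)
  then have "r dvd 3" by (simp add: cong_0_iff)
  moreover have "prime (3::nat)" by simp
  ultimately show False using assms(1,3) primes_dvd_imp_eq by blast
qed

lemma prime_dvd_core_mod_3:
  assumes "prime r" "r dvd core c"
  shows "r mod 3 = 1"
proof (rule prime_dvd_Phi3_mod_3)
  show "r dvd Phi3 c" by (subst Phi3_eq_core) (rule dvd_mult[OF assms(2)])
  show "r \<noteq> 3" using assms(2) not_3_dvd_core[of c] by auto
qed (fact assms(1))

section \<open>Coincidences between prime factors\<close>

text \<open>
  A product of at most two primes \<open>\<le> c\<close> would be at most \<open>c\<^sup>2\<close>.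
\<close>
lemma ex_prime_factor_greater:
  assumes "big_omega (Phi3 c) \<le> 2" "c > 0"
  shows "\<exists>q. prime q \<and> q dvd Phi3 c \<and> c < q"
proof (rule ccontr)
  assume *: "\<not> ?thesis"
  have "Phi3 c = prod_mset (prime_factorization (Phi3 c))"
    by (subst prod_mset_prime_factorization_nat) auto
  also have "\<dots> \<le> c ^ big_omega (Phi3 c)"
    unfolding big_omega_def using * by (intro prod_mset_le_power_size) (auto simp: in_prime_factors_iff not_less)
  also have "\<dots> \<le> c ^ 2"
    using assms by (intro power_increasing) auto
  finally show False by simp
qed

lemma Phi3_diff:
  "int (Phi3 c) - int (Phi3 d) = (int c - int d) * int (c + d + 1)"
  by (simp add: power2_eq_square algebra_simps)

lemma Phi3_inj:
  assumes "Phi3 c = Phi3 d"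
  shows "c = d"
proof -
  have "(int c - int d) * int (c + d + 1) = 0"
    unfolding Phi3_diff[symmetric] assms by simp
  then show ?thesis by simp
qed

text \<open>
  Modulo a prime, the roots of \<open>x\<^sup>2 + x + 1\<close> come in the pair \<open>c\<close>, \<open>- 1 - c\<close>. The two coincidence lemmas
  below both follow by bounding \<open>\<bar>c - d\<bar>\<close> and \<open>c + d + 1\<close>.
\<close>
lemma prime_dvd_two_Phi3:
  assumes "prime q" "q dvd Phi3 c" "q dvd Phi3 d"
  shows "int q dvd int c - int d \<or> q dvd c + d + 1"
proof -
  have "int q dvd int (Phi3 c) - int (Phi3 d)"
    using assms by (intro dvd_diff) (simp_all only: int_dvd_int_iff)
  then have "int q dvd (int c - int d) * int (c + d + 1)"
    unfolding Phi3_diff .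
  moreover have "prime (int q)" using assms(1) by simp
  ultimately have "int q dvd int c - int d \<or> int q dvd int (c + d + 1)"
    by (simp only: prime_dvd_mult_iff)
  then show ?thesis by (simp only: int_dvd_int_iff)
qed

text \<open>
  By size, two different \<open>c, d < q\<close> must satisfy \<open>c + d + 1 = q\<close>. This is impossible modulo 3, as the left side
  is 2 and the prime factor \<open>q\<close> of \<open>c\<^sup>2 + c + 1\<close> is 0 or 1.
\<close>
lemma greater_prime_factor_unique:
  assumes "prime q" "q dvd Phi3 c" "q dvd Phi3 d" "c < q" "d < q"
    and "c mod 3 = 2" "d mod 3 = 2"
  shows "c = d"
proof (rule ccontr)
  assume "c \<noteq> d"
  then have "\<not> int q dvd \<bar>int c - int d\<bar>"
    using assms by (intro zdvd_not_zless) auto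
  then have "\<not> int q dvd int c - int d" by simp
  then have "q dvd c + d + 1"
    using prime_dvd_two_Phi3[OF assms(1-3)] by simp
  then obtain k where k: "c + d + 1 = q * k" by blast
  have "q * k < q * 2" using k assms(4,5) by linarith
  then have "k < 2" by simp
  moreover have "k \<noteq> 0" using k by (intro notI) simp
  ultimately have "k = 1" by linarith
  then have "q = c + d + 1" using k by simp
  then have "q mod 3 = 2" using assms(6,7) by presburger
  moreover from this have "q \<noteq> 3" by auto
  ultimately show False using prime_dvd_Phi3_mod_3[OF assms(1,2)] by simp
qed

text \<open>
  The equation forces \<open>d < c < 2d\<close>, so \<open>c - d\<close> and \<open>c + d + 1\<close> are both positive and smaller than the prime
  \<open>d\<^sup>2 + d + 1\<close>, which has to divide one of them.
\<close>
lemma Phi3_neq_3_mult_prime_Phi3: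
  assumes "prime (Phi3 d)" "d > 2"
  shows "Phi3 c \<noteq> 3 * Phi3 d"
proof
  assume eq: "Phi3 c = 3 * Phi3 d"
  have sq: "d * d \<ge> 3 * d" using assms(2) by simp
  have "d < c"
  proof (rule ccontr)
    assume "\<not> d < c"
    then have "c * c \<le> d * d" "c \<le> d" by (auto intro: mult_mono)
    then show False using eq by (simp add: power2_eq_square)
  qed
  moreover have lt: "c < 2 * d"
  proof (rule ccontr)
    assume "\<not> c < 2 * d"
    then have le: "2 * d \<le> c" by simp
    from le have "(2 * d) * (2 * d) \<le> c * c" by (intro mult_le_mono)
    then have "4 * (d * d) + 2 * d + 1 \<le> Phi3 c" using le by (simp add: power2_eq_square)
    then show False using eq sq assms(2) by (simp add: power2_eq_square)
  qed
  moreover have small: "c + d + 1 < Phi3 d"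
    unfolding power2_eq_square using sq lt by linarith
  ultimately have "\<not> int (Phi3 d) dvd int c - int d"
    by (intro zdvd_not_zless) linarith+
  moreover have "\<not> Phi3 d dvd c + d + 1"
    using small by (intro nat_dvd_not_less) auto
  moreover have "int (Phi3 d) dvd int c - int d \<or> Phi3 d dvd c + d + 1"
    by (rule prime_dvd_two_Phi3[OF assms(1)]) (simp_all only: eq dvd_triv_right dvd_refl)
  ultimately show False by blast
qed

section \<open>Counting prime factors of an odd perfect number\<close>

lemma sum_indicator_eq_card: "(\<Sum>c\<in>A. if P c then 1 else 0) = card {c \<in> A. P c}" if "finite A" for A :: "nat set"
  using that by (simp flip: sum.inter_filter)

lemma even_sum_powers:
  fixes p :: nat
  assumes "odd p" "odd e"
  shows "even (\<Sum>i\<le>e. p ^ i)"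
  using assms by (simp add: even_sum_iff)

locale odd_perfect =
  fixes N :: nat
  assumes odd_N: "odd N" and perfect_N: "perfect N"
begin

abbreviation expo :: "nat \<Rightarrow> nat" where
  "expo p \<equiv> multiplicity p N"

definition "U = {c \<in> prime_factors N. expo c = 2 \<and> c mod 3 = 1}"
definition "V = {c \<in> prime_factors N. expo c = 2 \<and> c mod 3 = 2}"
definition "T = {c \<in> prime_factors N. expo c \<noteq> 2 \<and> c \<noteq> 3}"

lemma N_pos: "N > 0"
  using perfect_N by (simp add: perfect_def)

lemma finite_UVT [simp]: "finite U" "finite V" "finite T"
  by (auto simp: U_def V_def T_def)

lemma prod_sum_powers: "(\<Prod>p\<in>prime_factors N. \<Sum>i\<le>expo p. p ^ i) = 2 * N"
  using divisor_sum_eq_prod[OF N_pos] perfect_N by (simp add: perfect_def)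

lemma odd_prime_factor: "p \<in> prime_factors N \<Longrightarrow> odd p"
  using odd_N by (meson dvd_trans in_prime_factors_iff)

lemma prod_sum_powers_dvd:
  "A \<subseteq> prime_factors N \<Longrightarrow> (\<Prod>p\<in>A. \<Sum>i\<le>expo p. p ^ i) dvd 2 * N"
  unfolding prod_sum_powers[symmetric] by (intro prod_dvd_prod_subset) auto

text \<open>
  Every prime of odd exponent contributes an even factor to \<open>\<sigma>(N) = 2N\<close>, which is not divisible by 4.
\<close>
lemma card_odd_exponents: "card {p \<in> prime_factors N. odd (expo p)} \<le> 1"
proof -
  have "p = q" if pq: "p \<in> prime_factors N" "odd (expo p)" "q \<in> prime_factors N" "odd (expo q)" for p q
  proof (rule ccontr)
    assume ne: "p \<noteq> q"
    let ?s = "\<lambda>p. \<Sum>i\<le>expo p. p ^ i"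
    have "2 * 2 dvd ?s p * ?s q"
      by (intro mult_dvd_mono even_sum_powers odd_prime_factor pq)
    also have "?s p * ?s q = (\<Prod>p\<in>{p, q}. ?s p)"
      using ne by simp
    also have "\<dots> dvd 2 * N"
      using pq by (intro prod_sum_powers_dvd) auto
    finally show False using odd_N by simp
  qed
  then show ?thesis
    by (simp add: card_le_Suc0_iff_eq)
qed

text \<open>
  The summand 3 pays for the prime of odd exponent, whose exponent may be 1; all other exponents on \<open>T\<close> are
  even and not 2.
\<close>
lemma sum_expo_T: "(\<Sum>p\<in>T. expo p) + 3 \<ge> 4 * card T"
proof -
  have "4 * card T = (\<Sum>p\<in>T. 4)" by simp
  also have "\<dots> \<le> (\<Sum>p\<in>T. expo p + (if odd (expo p) then 3 else 0))"
  proof (rule sum_mono)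
    fix p assume p: "p \<in> T"
    then have "expo p > 0"
      by (auto simp: T_def prime_factors_multiplicity)
    moreover have "expo p \<noteq> 2" using p by (simp add: T_def)
    ultimately show "4 \<le> expo p + (if odd (expo p) then 3 else 0)" by presburger
  qed
  also have "\<dots> = (\<Sum>p\<in>T. expo p) + 3 * card {p \<in> T. odd (expo p)}"
    by (simp add: sum.distrib flip: sum.inter_filter)
  also have "card {p \<in> T. odd (expo p)} \<le> card {p \<in> prime_factors N. odd (expo p)}"
    by (intro card_mono) (auto simp: T_def)
  finally show ?thesis using card_odd_exponents by linarith
qed

lemma UV_gt_2: "c \<in> U \<union> V \<Longrightarrow> c > 2"
  using odd_prime_factor[of c] prime_gt_1_nat[of c] by (cases "c = 2") (auto simp: U_def V_def in_prime_factors_iff)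

lemma U_V_disjoint: "U \<inter> V = {}"
  by (auto simp: U_def V_def)

text \<open>
  The numbers \<open>\<sigma>(c\<^sup>2)\<close> for \<open>c \<in> U \<union> V\<close> are distinct factors in the product formula for \<open>\<sigma>(N) = 2N\<close>, and
  they are odd.
\<close>
lemma prod_core_dvd: "3 ^ card U * (\<Prod>c\<in>U \<union> V. core c) dvd N"
proof -
  have eqU: "(\<Prod>c\<in>U. Phi3 c) = 3 ^ card U * (\<Prod>c\<in>U. core c)"
  proof -
    have "(\<Prod>c\<in>U. Phi3 c) = (\<Prod>c\<in>U. 3 * core c)"
      by (intro prod.cong refl, subst Phi3_eq_core) (simp add: U_def)
    then show ?thesis by (simp only: prod.distrib prod_constant)
  qed
  have eqV: "(\<Prod>c\<in>V. Phi3 c) = (\<Prod>c\<in>V. core c)"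
    by (intro prod.cong refl, subst Phi3_eq_core) (simp add: V_def)
  have union: "(\<Prod>c\<in>U \<union> V. f c) = (\<Prod>c\<in>U. f c) * (\<Prod>c\<in>V. f c)" for f :: "nat \<Rightarrow> nat"
    using U_V_disjoint by (intro prod.union_disjoint) auto
  have eq: "3 ^ card U * (\<Prod>c\<in>U \<union> V. core c) = (\<Prod>c\<in>U \<union> V. Phi3 c)"
    unfolding union eqU eqV by (rule mult.assoc[symmetric])
  have "(\<Prod>c\<in>U \<union> V. Phi3 c) = (\<Prod>c\<in>U \<union> V. \<Sum>i\<le>expo c. c ^ i)"
    by (intro prod.cong refl) (auto simp: U_def V_def numeral_2_eq_2)
  moreover have "(\<Prod>c\<in>U \<union> V. \<Sum>i\<le>expo c. c ^ i) dvd 2 * N"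
    by (intro prod_sum_powers_dvd) (auto simp: U_def V_def)
  ultimately have "3 ^ card U * (\<Prod>c\<in>U \<union> V. core c) dvd 2 * N"
    unfolding eq by (simp only:)
  moreover have "odd (\<Prod>c\<in>U \<union> V. Phi3 c)"
    by (simp add: even_prod_iff)
  then have "coprime (3 ^ card U * (\<Prod>c\<in>U \<union> V. core c)) 2"
    unfolding eq by simp
  ultimately show ?thesis
    by (simp only: coprime_dvd_mult_right_iff)
qed

lemma card_U_le_expo_3: "card U \<le> expo 3"
proof (rule multiplicity_geI)
  show "3 ^ card U dvd N" using prod_core_dvd by (rule dvd_mult_left)
qed (use N_pos in auto)

text \<open>
  The prime \<open>r\<close> divides \<open>N\<close> and is 1 mod 3, so it is neither 3 nor an element of \<open>V\<close>.
\<close>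
lemma core_prime_in_UT:
  assumes "prime r" "r dvd core c" "c \<in> U \<union> V"
  shows "r \<in> U \<union> T"
proof -
  have "core c dvd (\<Prod>c\<in>U \<union> V. core c)"
    using assms(3) by (intro dvd_prodI) auto
  then have "r dvd N"
    using dvd_trans[OF assms(2)] dvd_mult_right[OF prod_core_dvd] by (metis dvd_trans)
  moreover have "r mod 3 = 1" using assms(1,2) by (rule prime_dvd_core_mod_3)
  ultimately show ?thesis
    using assms(1) N_pos by (auto simp: U_def T_def in_prime_factors_iff)
qed

lemma sum_big_omega_core:
  "(\<Sum>c\<in>U \<union> V. big_omega (core c)) \<le> 2 * card U + (\<Sum>p\<in>T. expo p)"
proof -
  let ?M = "prime_factorization (\<Prod>c\<in>U \<union> V. core c)"
  have pos: "core c \<noteq> 0" if "c \<in> U \<union> V" for c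
    using not_3_dvd_core[of c] by (metis dvd_0_right)
  have "?M = (\<Sum>c\<in>U \<union> V. prime_factorization (core c))"
    using pos by (intro prime_factorization_prod) auto
  then have "(\<Sum>c\<in>U \<union> V. big_omega (core c)) = size ?M"
    by (simp add: big_omega_def size_multiset_sum)
  also have "\<dots> = (\<Sum>p\<in>set_mset ?M. count ?M p)"
    by (simp add: size_multiset_overloaded_eq)
  also have "\<dots> \<le> (\<Sum>p\<in>set_mset ?M. expo p)"
  proof (rule sum_mono)
    fix p assume "p \<in> set_mset ?M"
    then have "prime p" by auto
    moreover have "(\<Prod>c\<in>U \<union> V. core c) dvd N"
      using prod_core_dvd by (rule dvd_mult_right)
    ultimately show "count ?M p \<le> expo p"
      using N_pos by (simp add: count_prime_factorization_prime dvd_imp_multiplicity_le)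
  qed
  also have "\<dots> \<le> (\<Sum>p\<in>U \<union> T. expo p)"
  proof (rule sum_mono2)
    show "set_mset ?M \<subseteq> U \<union> T"
    proof
      fix p assume "p \<in> set_mset ?M"
      then have "prime p" "p dvd (\<Prod>c\<in>U \<union> V. core c)"
        by (auto simp: in_prime_factors_iff)
      then obtain c where "c \<in> U \<union> V" "p dvd core c"
        by (auto simp: prime_dvd_prod_iff)
      then show "p \<in> U \<union> T" using \<open>prime p\<close> core_prime_in_UT by blast
    qed
  qed auto
  also have "\<dots> = (\<Sum>p\<in>U. expo p) + (\<Sum>p\<in>T. expo p)"
    by (intro sum.union_disjoint) (auto simp: U_def T_def)
  also have "(\<Sum>p\<in>U. expo p) = (\<Sum>p\<in>U. 2)"
    by (intro sum.cong refl) (auto simp: U_def)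
  finally show ?thesis by simp
qed

lemma card_UT: "card (U \<union> T) = card U + card T"
  by (intro card_Un_disjoint) (auto simp: U_def T_def)

text \<open>
  On \<open>V\<close> we have \<open>core c = c\<^sup>2 + c + 1\<close>, so choosing a prime factor \<open>q > c\<close> of it is an injection into
  \<open>U \<union> T\<close>.
\<close>
lemma card_V_at_most_two:
  "card {c \<in> V. big_omega (core c) \<le> 2} \<le> card U + card T"
proof -
  let ?W = "{c \<in> V. big_omega (core c) \<le> 2}"
  have core: "core c = Phi3 c" "c mod 3 = 2" if "c \<in> V" for c
    using that by (simp_all add: V_def core_def)
  have "\<forall>c\<in>?W. \<exists>q. prime q \<and> q dvd Phi3 c \<and> c < q"
  proof
    fix c assume c: "c \<in> ?W"
    then have "c \<in> V" by simp
    with c have "big_omega (Phi3 c) \<le> 2" by (simp only: core(1) mem_Collect_eq)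
    moreover have "c > 0" using UV_gt_2[of c] \<open>c \<in> V\<close> by simp
    ultimately show "\<exists>q. prime q \<and> q dvd Phi3 c \<and> c < q" by (rule ex_prime_factor_greater)
  qed
  from bchoice[OF this] obtain g where
    g: "\<And>c. c \<in> ?W \<Longrightarrow> prime (g c) \<and> g c dvd Phi3 c \<and> c < g c" by blast
  have inj: "inj_on g ?W"
  proof (rule inj_onI)
    fix c d assume cd: "c \<in> ?W" "d \<in> ?W" "g c = g d"
    show "c = d"
    proof (rule greater_prime_factor_unique)
      show "prime (g c)" "g c dvd Phi3 c" "c < g c" using g[OF cd(1)] by blast+
      show "g c dvd Phi3 d" "d < g c" using g[OF cd(2)] unfolding cd(3) by blast+
      show "c mod 3 = 2" "d mod 3 = 2" using cd(1,2) core(2) by blast+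
    qed
  qed
  have img: "g ` ?W \<subseteq> U \<union> T"
  proof (rule image_subsetI)
    fix c assume c: "c \<in> ?W"
    then have "c \<in> V" by simp
    then show "g c \<in> U \<union> T"
      using g[OF c] by (intro core_prime_in_UT[of "g c" c]) (simp_all add: core(1))
  qed
  have "card ?W \<le> card (U \<union> T)"
    by (rule card_inj_on_le[OF inj img]) simp
  then show ?thesis using card_UT by simp
qed

text \<open>
  The map \<open>core\<close> is injective on each of \<open>U\<close> and \<open>V\<close>. A common prime value at \<open>c \<in> U\<close> and \<open>d \<in> V\<close> would mean
  \<open>c\<^sup>2 + c + 1 = 3 (d\<^sup>2 + d + 1)\<close>.
\<close>
lemma card_core_prime:
  "card {c \<in> U. prime (core c)} + card {c \<in> V. prime (core c)} \<le> card U + card T"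
proof -
  let ?U1 = "{c \<in> U. prime (core c)}" and ?V1 = "{c \<in> V. prime (core c)}"
  have core_U: "Phi3 c = 3 * core c" if "c \<in> U" for c
    using that by (subst Phi3_eq_core) (simp add: U_def)
  have core_V: "Phi3 c = core c" if "c \<in> V" for c
    using that by (subst Phi3_eq_core) (simp add: V_def)
  have "inj_on core U"
    by (rule inj_onI, rule Phi3_inj) (simp only: core_U)
  moreover have "inj_on core V"
    by (rule inj_onI, rule Phi3_inj) (simp only: core_V)
  moreover have mixed: "core c \<noteq> core d" if "c \<in> U" "d \<in> V" "prime (core d)" for c d
  proof
    assume eq: "core c = core d"
    have "prime (Phi3 d)" using that(3) unfolding core_V[OF that(2)] .
    moreover have "d > 2" using UV_gt_2[of d] that(2) by simp
    ultimately have "Phi3 c \<noteq> 3 * Phi3 d" by (rule Phi3_neq_3_mult_prime_Phi3)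
    then show False unfolding core_U[OF that(1)] core_V[OF that(2)] eq by simp
  qed
  ultimately have inj: "inj_on core (?U1 \<union> ?V1)"
    unfolding inj_on_Un by (blast intro: inj_on_subset)
  have img: "core ` (?U1 \<union> ?V1) \<subseteq> U \<union> T"
    by (rule image_subsetI, rule core_prime_in_UT) auto
  have "card (?U1 \<union> ?V1) \<le> card (U \<union> T)"
    by (rule card_inj_on_le[OF inj img]) simp
  moreover have "card (?U1 \<union> ?V1) = card ?U1 + card ?V1"
    using U_V_disjoint by (intro card_Un_disjoint) auto
  ultimately show ?thesis using card_UT by simp
qed

lemma big_omega_core:
  assumes "c \<in> U \<union> V"
  shows "big_omega (core c) \<ge> 1" "\<not> prime (core c) \<Longrightarrow> big_omega (core c) \<ge> 2"
proof -
  have gt: "core c > 1"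
    using core_gt_1 UV_gt_2[OF assms] by simp
  show *: "big_omega (core c) \<ge> 2" if "\<not> prime (core c)"
    using prime_if_big_omega_le_1[OF gt] that by linarith
  show "big_omega (core c) \<ge> 1"
    using * by (cases "prime (core c)") (simp_all add: big_omega_def prime_factorization_prime)
qed

lemma sum_big_omega_U:
  "2 * card U \<le> (\<Sum>c\<in>U. big_omega (core c)) + card {c \<in> U. prime (core c)}"
proof -
  have "2 * card U = (\<Sum>c\<in>U. 2)" by simp
  also have "\<dots> \<le> (\<Sum>c\<in>U. big_omega (core c) + (if prime (core c) then 1 else 0))"
  proof (rule sum_mono)
    fix c assume "c \<in> U"
    then show "2 \<le> big_omega (core c) + (if prime (core c) then 1 else 0)"
      using big_omega_core[of c] by (cases "prime (core c)") simp_all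
  qed
  finally show ?thesis unfolding sum.distrib sum_indicator_eq_card[OF finite_UVT(1)] .
qed

lemma sum_big_omega_V:
  "3 * card V \<le> (\<Sum>c\<in>V. big_omega (core c)) + card {c \<in> V. prime (core c)} +
    card {c \<in> V. big_omega (core c) \<le> 2}"
proof -
  have "3 * card V = (\<Sum>c\<in>V. 3)" by simp
  also have "\<dots> \<le> (\<Sum>c\<in>V. big_omega (core c) + (if prime (core c) then 1 else 0) +
      (if big_omega (core c) \<le> 2 then 1 else 0))"
  proof (rule sum_mono)
    fix c assume "c \<in> V"
    then show "3 \<le> big_omega (core c) + (if prime (core c) then 1 else 0) +
        (if big_omega (core c) \<le> 2 then 1 else 0)"
      using big_omega_core[of c] by (cases "prime (core c)") simp_all
  qed
  finally show ?thesis unfolding sum.distrib sum_indicator_eq_card[OF finite_UVT(2)] .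
qed

text \<open>
  The contributions \<open>2u\<close> of \<open>U\<close> cancel: what its elements require as prime factors of the cores is what they
  supply through their own exponents.
\<close>
lemma key_inequality:
  "3 * card V \<le> card {c \<in> U. prime (core c)} + card {c \<in> V. prime (core c)} +
    card {c \<in> V. big_omega (core c) \<le> 2} + (\<Sum>p\<in>T. expo p)"
proof -
  have "(\<Sum>c\<in>U \<union> V. big_omega (core c)) = (\<Sum>c\<in>U. big_omega (core c)) + (\<Sum>c\<in>V. big_omega (core c))"
    using U_V_disjoint by (intro sum.union_disjoint) auto
  then show ?thesis
    using sum_big_omega_core sum_big_omega_U sum_big_omega_V by linarith
qed

lemma prime_factors_split:
  "prime_factors N = (prime_factors N \<inter> {3}) \<union> (U \<union> V \<union> T)"
proof -
  have "c mod 3 = 1 \<or> c mod 3 = 2" if "prime c" "c \<noteq> 3" for c :: nat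
  proof -
    have "\<not> 3 dvd c" using that primes_dvd_imp_eq[of 3 c] by auto
    then show ?thesis by presburger
  qed
  then show ?thesis
    by (auto simp: U_def V_def T_def in_prime_factors_iff)
qed

lemma sum_prime_factors:
  fixes f :: "nat \<Rightarrow> nat"
  shows "(\<Sum>p\<in>prime_factors N. f p) =
    (if 3 dvd N then f 3 else 0) + (\<Sum>p\<in>U. f p) + (\<Sum>p\<in>V. f p) + (\<Sum>p\<in>T. f p)"
proof -
  have "(\<Sum>p\<in>prime_factors N. f p) = (\<Sum>p\<in>prime_factors N \<inter> {3}. f p) + (\<Sum>p\<in>U \<union> V \<union> T. f p)"
    by (subst prime_factors_split, intro sum.union_disjoint) (auto simp: U_def V_def T_def)
  also have "(\<Sum>p\<in>U \<union> V \<union> T. f p) = (\<Sum>p\<in>U \<union> V. f p) + (\<Sum>p\<in>T. f p)"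
    by (intro sum.union_disjoint) (auto simp: U_def V_def T_def)
  also have "(\<Sum>p\<in>U \<union> V. f p) = (\<Sum>p\<in>U. f p) + (\<Sum>p\<in>V. f p)"
    using U_V_disjoint by (intro sum.union_disjoint) auto
  also have "(\<Sum>p\<in>prime_factors N \<inter> {3}. f p) = (if 3 dvd N then f 3 else 0)"
    using N_pos by (auto simp: Int_insert_right in_prime_factors_iff)
  finally show ?thesis by simp
qed

lemma small_omega_eq:
  "small_omega N = (if 3 dvd N then 1 else 0) + card U + card V + card T"
  using sum_prime_factors[of "\<lambda>_. 1"] by (simp add: small_omega_def)

lemma big_omega_eq:
  "big_omega N = expo 3 + 2 * card U + 2 * card V + (\<Sum>p\<in>T. expo p)"
proof -
  have "big_omega N = (\<Sum>p\<in>prime_factors N. count (prime_factorization N) p)"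
    by (simp add: big_omega_def size_multiset_overloaded_eq)
  also have "\<dots> = (\<Sum>p\<in>prime_factors N. expo p)"
    by (intro sum.cong refl count_prime_factorization_prime in_prime_factors_imp_prime)
  also have "\<dots> = expo 3 + (\<Sum>p\<in>U. expo p) + (\<Sum>p\<in>V. expo p) + (\<Sum>p\<in>T. expo p)"
    by (simp add: sum_prime_factors not_dvd_imp_multiplicity_0)
  also have "(\<Sum>p\<in>U. expo p) = (\<Sum>p\<in>U. 2)" by (intro sum.cong refl) (auto simp: U_def)
  also have "(\<Sum>p\<in>V. expo p) = (\<Sum>p\<in>V. 2)" by (intro sum.cong refl) (auto simp: V_def)
  finally show ?thesis by simp
qed

text \<open>
  With \<open>u = 0\<close> the facts read \<open>3v \<le> 2t + R\<close> and \<open>R \<ge> 4t - 3\<close>; adding twice the first to 7 times the second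
  gives three times the claim.
\<close>
lemma bound_not_3_dvd:
  assumes "\<not> 3 dvd N"
  shows "8 * small_omega N \<le> 3 * big_omega N + 7"
proof -
  have "expo 3 = 0" using assms by (rule not_dvd_imp_multiplicity_0)
  then show ?thesis
    using assms small_omega_eq big_omega_eq card_U_le_expo_3 sum_expo_T key_inequality
      card_V_at_most_two card_core_prime by simp
qed

text \<open>
  Let \<open>a\<close> count the \<open>c \<in> U \<union> V\<close> with prime core and \<open>b\<close> the \<open>c \<in> V\<close> with \<open>\<Omega>(core c) \<le> 2\<close>. The claim is the sum
  of \<open>3v \<le> a + b + R\<close> with weight 2, \<open>a \<le> u + t\<close> with weight 2, \<open>b \<le> u + t\<close> and \<open>b \<le> v\<close> with weight 1,
  \<open>R \<ge> 4t - 3\<close> with weight 6, and \<open>u \<le> e\<close> with weight 8.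
\<close>
lemma bound_3_dvd:
  assumes "3 dvd N"
  shows "21 * small_omega N \<le> 8 * big_omega N + 39"
proof -
  have "card {c \<in> V. big_omega (core c) \<le> 2} \<le> card V"
    by (intro card_mono) auto
  then show ?thesis
    using assms small_omega_eq big_omega_eq card_U_le_expo_3 sum_expo_T key_inequality
      card_V_at_most_two card_core_prime by simp
qed

end

theorem theorem1:
  fixes N :: nat
  assumes "odd N" and "perfect N"
  shows "(\<not> 3 dvd N \<longrightarrow> real (big_omega N) \<ge> 8 / 3 * real (small_omega N) - 7 / 3) \<and>
         (3 dvd N \<longrightarrow> real (big_omega N) \<ge> 21 / 8 * real (small_omega N) - 39 / 8)"
proof -
  interpret odd_perfect N using assms by unfold_locales
  have "real (8 * small_omega N) \<le> real (3 * big_omega N + 7)" if "\<not> 3 dvd N"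
    using bound_not_3_dvd[OF that] by (rule of_nat_mono)
  moreover have "real (21 * small_omega N) \<le> real (8 * big_omega N + 39)" if "3 dvd N"
    using bound_3_dvd[OF that] by (rule of_nat_mono)
  ultimately show ?thesis by auto
qed

end
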